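(* Let $s>0$, let $h:\mathbb{R}^n\to[0,\infty)$ be a proper log-concave function and suppose that $\hslash_{B^{n+1}}^s$ is its John $s$-function. Assume $$\Lambda=\{x\in B^n:h(x)^{1/s}=\hslash_{B^{n+1}}(x)\}=\{x_1,\dots,x_m\}.$$ Let $F\in\mathcal{W}$ be any $C^1$ function. Consider the convex functional $\bar I_c:\mathcal{E}\to\mathbb{R}$ defined by $$\bar I_c(M\oplus\beta,w)=\sum_{i=1}^m h(x_i)^{1/s}F\left(\frac{\langle x_i,Mx_i+w\rangle}{h(x_i)^{2/s}}+\beta\right).$$ If the restriction of $\bar I_c$ to ${}^{(s)}\mathrm{Sym}_{n+1,0}(\mathbb{R})\times\mathbb{R}^n$ is coercive, then for any global minimum $(M_0\oplus\beta_0,w_0)$ of this restriction, the numbers $$c_i=\frac{1}{h(x_i)^{1/s}}F'\left(\frac{\langle x_i,M_0x_i+w_0\rangle}{h(x_i)^{2/s}}+\beta_0\right),\qquad i=1,\dots,m,$$ together with the vectors $x_i\in B^n$, $i=1,\dots,m$, satisfy the following conditions: the $c_i$ are positive weights, and (a) $h(x_i)=\hslash_{B^{n+1}}^s(x_i)$ for all $i=1,\dots,m$; (b) $\sum_{i=1}^m c_i\,x_i\otimes x_i=\mathrm{Id}$; (c) $\sum_{i=1}^m c_i\,h(x_i)^{1/s}h(x_i)^{1/s}=s$; (d) $\sum_{i=1}^m c_i x_i=0$.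
   Context: Notation: $|\cdot|_2$ is the Euclidean norm, $\langle\cdot,\cdot\rangle$ the standard inner product, $B^d$ the closed unit Euclidean ball of $\mathbb{R}^d$, $v\otimes w=vw^T$, $\mathrm{Id}$ the $n\times n$ identity. For an $n\times n$ matrix $A$ and $\alpha\in\mathbb{R}$, $A\oplus\alpha$ is the $(n+1)\times(n+1)$ block diagonal matrix with blocks $A$ and $\alpha$. A function $h:\mathbb{R}^n\to[0,\infty)$ is log-concave if $h=e^{-\varphi}$ with $\varphi:\mathbb{R}^n\to(-\infty,+\infty]$ convex; it is proper if moreover it is upper semicontinuous and has finite positive integral. John $s$-function: the $s$-lifting of $h$ is ${}^{(s)}\bar h=\{(x,\xi)\in\mathbb{R}^{n}\times\mathbb{R}:|\xi|\le h(x)^{1/s}\}$. An $n$-symmetric ellipsoid in $\mathbb{R}^{n+1}$ is a set $(A\oplus\alpha)B^{n+1}+(a,0)$ with $A$ symmetric positive definite $n\times n$, $\alpha>0$, $a\in\mathbb{R}^n$. The $s$-volume of a Borel set $\bar C\subset\mathbb{R}^{n+1}$ symmetric under $(x,t)\mapsto(x,-t)$ is $\int_{\mathbb{R}^n}[\frac12 \ell(\bar C\cap l_x)]^s dx$, where $l_x=\{x\}\times\mathbb{R}$ and $\ell$ is one-dimensional Lebesgue measure. For a proper log-concave $h$ there is a unique $n$-symmetric ellipsoid of maximal $s$-volume contained in ${}^{(s)}\bar h$, the John $s$-ellipsoid $\bar E$ of $h$; the function $x\mapsto[\frac12\ell(\bar E\cap l_x)]^s$ is the John $s$-function of $h$.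 With $\hslash_{B^{n+1}}(x)=\sqrt{1-|x|_2^2}$ for $x\in B^n$ and $0$ otherwise, "$\hslash_{B^{n+1}}^s$ is the John $s$-function of $h$" means that $B^{n+1}$ is the John $s$-ellipsoid of $h$. $\mathcal{E}=\{(A\oplus\alpha,a): A \text{ a symmetric } n\times n \text{ matrix},\ \alpha\in\mathbb{R},\ a\in\mathbb{R}^n\}$. The $s$-trace is ${}^{(s)}\mathrm{tr}(M\oplus\beta)=s\beta+\mathrm{tr}(M)$, and ${}^{(s)}\mathrm{Sym}_{n+1,0}(\mathbb{R})=\{M\oplus\beta: M \text{ symmetric},\ \beta\in\mathbb{R},\ {}^{(s)}\mathrm{tr}(M\oplus\beta)=0\}$. $\mathcal{W}$ is the set of functions $F:\mathbb{R}\to[0,\infty)$ that are non-decreasing, convex, strictly convex on $[0,\infty)$, and satisfy $F'(0)>0$. A real function on a finite-dimensional normed space is coercive if it tends to $+\infty$ as the norm of the argument tends to $\infty$.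
   Formalization: (b)-(d) are proved for c_i/λ with λ=(Σc_i)/(n+s)>0, since replacing F by 2F doubles the c_i; the c_i are proved nonnegative, and positive when h(x_i)>0 and F is not at its least value at the argument, since F may be constant on a half-line and then c_i can be 0. *)

theory Defs
  imports "HOL-Analysis.Analysis"
begin

section \<open>Log-concave functions\<close>

text \<open>\<open>\<phi>\<close> takes values in \<open>(-\<infinity>, \<infinity>]\<close>. In type \<open>ereal\<close> one has \<open>0 * \<infinity> = 0\<close>, so the
  convexity inequality carries no spurious constraint at the end points \<open>t = 0, 1\<close>.\<close>

definition ext_convex :: "('a::real_vector \<Rightarrow> ereal) \<Rightarrow> bool" where
  "ext_convex \<phi> \<longleftrightarrow> (\<forall>x. \<phi> x \<noteq> -\<infinity>) \<and>
     (\<forall>x y. \<forall>t\<in>{0..1::real}.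
        \<phi> ((1 - t) *\<^sub>R x + t *\<^sub>R y) \<le> ereal (1 - t) * \<phi> x + ereal t * \<phi> y)"

definition log_concave :: "('a::real_vector \<Rightarrow> real) \<Rightarrow> bool" where
  "log_concave h \<longleftrightarrow> (\<exists>\<phi>. ext_convex \<phi> \<and>
     (\<forall>x. h x = (if \<phi> x = \<infinity> then 0 else exp (- real_of_ereal (\<phi> x)))))"

definition upper_semicont :: "('a::topological_space \<Rightarrow> real) \<Rightarrow> bool" where
  "upper_semicont h \<longleftrightarrow> (\<forall>x c. h x < c \<longrightarrow> (\<forall>\<^sub>F y in nhds x. h y < c))"

definition proper_log_concave :: "('a::euclidean_space \<Rightarrow> real) \<Rightarrow> bool" where
  "proper_log_concave h \<longleftrightarrow> log_concave h \<and> upper_semicont h \<and>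
     integrable lborel h \<and> 0 < (\<integral>x. h x \<partial>lborel)"


section \<open>The John \<open>s\<close>-ellipsoid\<close>

text \<open>\<open>\<real>\<^sup>n\<^sup>+\<^sup>1 = \<real>\<^sup>n \<times> \<real>\<close> is rendered as the type \<open>(real ^ 'n) \<times> real\<close>, whose library norm is the
  Euclidean one, so that \<open>cball 0 1\<close> is the ball \<open>B\<^sup>n\<^sup>+\<^sup>1\<close>. The block diagonal matrix \<open>A \<oplus> \<alpha>\<close> is
  rendered as the pair \<open>(A, \<alpha>)\<close>; it acts by \<open>(x, t) \<mapsto> (A x, \<alpha> t)\<close>.\<close>

definition lifting :: "real \<Rightarrow> ('a \<Rightarrow> real) \<Rightarrow> ('a \<times> real) set" where
  "lifting s h = {(x, \<xi>). \<bar>\<xi>\<bar> \<le> h x powr (1 / s)}"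

definition pos_def :: "real ^ 'n ^ 'n \<Rightarrow> bool" where
  "pos_def A \<longleftrightarrow> transpose A = A \<and> (\<forall>x. x \<noteq> 0 \<longrightarrow> 0 < x \<bullet> (A *v x))"

definition n_symmetric_ellipsoid :: "((real ^ 'n) \<times> real) set \<Rightarrow> bool" where
  "n_symmetric_ellipsoid E \<longleftrightarrow> (\<exists>A \<alpha> a. pos_def A \<and> 0 < \<alpha> \<and>
     E = (\<lambda>(x, t). (A *v x + a, \<alpha> * t)) ` cball 0 1)"

text \<open>The integrand is extended by \<open>\<infinity>\<close> at those \<open>x\<close> whose fibre has infinite length.\<close>

definition s_volume :: "real \<Rightarrow> ((real ^ 'n) \<times> real) set \<Rightarrow> ennreal" where
  "s_volume s C = (\<integral>\<^sup>+ x.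
     (let L = emeasure lborel {t. (x, t) \<in> C}
      in if L = \<infinity> then \<infinity> else ennreal ((enn2real L / 2) powr s)) \<partial>lborel)"

definition john_ellipsoid ::
    "real \<Rightarrow> (real ^ 'n \<Rightarrow> real) \<Rightarrow> ((real ^ 'n) \<times> real) set \<Rightarrow> bool" where
  "john_ellipsoid s h E \<longleftrightarrow>
     n_symmetric_ellipsoid E \<and> E \<subseteq> lifting s h \<and>
     (\<forall>E'. n_symmetric_ellipsoid E' \<and> E' \<subseteq> lifting s h \<longrightarrow> s_volume s E' \<le> s_volume s E)"

definition hbar :: "'a::real_normed_vector \<Rightarrow> real" where
  "hbar x = (if x \<in> cball 0 1 then sqrt (1 - (norm x)\<^sup>2) else 0)"


section \<open>The functional\<close>

definition sym_space :: "(((real ^ 'n ^ 'n) \<times> real) \<times> (real ^ 'n)) set" where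
  "sym_space = {((M, \<beta>), w). transpose M = M}"

definition s_trace :: "real \<Rightarrow> (real ^ 'n ^ 'n) \<times> real \<Rightarrow> real" where
  "s_trace s = (\<lambda>(M, \<beta>). s * \<beta> + trace M)"

definition Sym0 :: "real \<Rightarrow> ((real ^ 'n ^ 'n) \<times> real) set" where
  "Sym0 s = {(M, \<beta>). transpose M = M \<and> s_trace s (M, \<beta>) = 0}"

text \<open>The hypothesis \<open>F'(0) > 0\<close> includes the existence of the derivative at \<open>0\<close>; away from \<open>0\<close>
  no smoothness is required.\<close>

definition class_W :: "(real \<Rightarrow> real) set" where
  "class_W = {F. (\<forall>t. 0 \<le> F t) \<and> mono F \<and> convex_on UNIV F \<and>
     (\<forall>u\<ge>0. \<forall>v\<ge>0. \<forall>t\<in>{0<..<1}. u \<noteq> v \<longrightarrow>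
        F ((1 - t) * u + t * v) < (1 - t) * F u + t * F v) \<and>
     F differentiable (at 0) \<and> 0 < deriv F 0}"

definition coercive_on :: "'a::real_normed_vector set \<Rightarrow> ('a \<Rightarrow> real) \<Rightarrow> bool" where
  "coercive_on S f \<longleftrightarrow> filterlim f at_top (inf at_infinity (principal S))"

definition F_arg :: "real \<Rightarrow> (real ^ 'n \<Rightarrow> real) \<Rightarrow>
    ((real ^ 'n ^ 'n) \<times> real) \<times> (real ^ 'n) \<Rightarrow> real ^ 'n \<Rightarrow> real" where
  "F_arg s h = (\<lambda>((M, \<beta>), w) x. (x \<bullet> (M *v x + w)) / h x powr (2 / s) + \<beta>)"

definition I_c :: "real \<Rightarrow> (real ^ 'n \<Rightarrow> real) \<Rightarrow> (real \<Rightarrow> real) \<Rightarrow> nat \<Rightarrow> (nat \<Rightarrow> real ^ 'n) \<Rightarrow>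
    ((real ^ 'n ^ 'n) \<times> real) \<times> (real ^ 'n) \<Rightarrow> real" where
  "I_c s h F m x p = (\<Sum>i = 1..m. h (x i) powr (1 / s) * F (F_arg s h p (x i)))"

definition outer :: "real ^ 'n \<Rightarrow> real ^ 'n \<Rightarrow> real ^ 'n ^ 'n" where
  "outer v w = (\<chi> i j. v $ i * w $ j)"

text \<open>Normalisation and positivity of the weights. Put
  \<open>\<tau>\<^sub>i = \<langle>x\<^sub>i, M\<^sub>0 x\<^sub>i + w\<^sub>0\<rangle> / h(x\<^sub>i)\<^sup>2\<^sup>/\<^sup>s + \<beta>\<^sub>0\<close> and \<open>c\<^sub>i = F'(\<tau>\<^sub>i) / h(x\<^sub>i)\<^sup>1\<^sup>/\<^sup>s\<close>.
  Replacing \<open>F\<close> by \<open>2 F\<close> keeps all hypotheses and all minimisers but doubles the \<open>c\<^sub>i\<close>, so the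
  decomposition of the identity can only hold for the \<open>c\<^sub>i\<close> up to a common factor. Taking traces,
  that factor is forced to be \<open>\<lambda> = (\<Sum>i. c\<^sub>i) / (n + s)\<close>.

  The class \<open>class_W\<close> contains functions that are constant on a half line \<open>(-\<infinity>, -\<delta>]\<close>,
  for which some of the \<open>c\<^sub>i\<close> may vanish at the minimum. An example with \<open>n = s = 1\<close>: take
  \<open>F(t) = (max 0 (1 + t))\<^sup>2 / 2\<close>, the contact points \<open>0, \<plusminus>12/13, \<plusminus>24/25\<close>, and for
  \<open>h\<close> the minimum of the exponentials of the tangent lines to \<open>ln (sqrt (1 - x\<^sup>2))\<close> there.
  The minimum is at \<open>\<beta> = -M = 4325/29947\<close>, \<open>w = 0\<close>, and the weights of \<open>\<plusminus>24/25\<close> are zero.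
  In general \<open>c\<^sub>i > 0\<close> unless \<open>F\<close> attains its least value at \<open>\<tau>\<^sub>i\<close>; in particular all \<open>c\<^sub>i\<close>
  are positive if \<open>F\<close> is strictly increasing.\<close>

end

theory Submission
  imports Defs
begin

text \<open>The functional \<open>I_c\<close> is a sum of convex functions of linear forms, so at a minimum on the
  hyperplane its directional derivatives vanish; testing with \<open>(0 \<oplus> 0, w)\<close> and with
  \<open>(M \<oplus> (- trace M / s), 0)\<close> gives the decomposition of the identity up to a factor \<open>\<mu> \<ge> 0\<close>.
  If \<open>\<mu> = 0\<close>, then all weights vanish, \<open>F\<close> is minimal at all \<open>\<tau>\<^sub>i\<close>, which are therefore negative,
  and \<open>I_c\<close> is constant along the ray through the minimiser, contradicting coercivity.
  Contact points with \<open>h (x i) = 0\<close> drop out of both \<open>I_c\<close> and the weights, because \<open>0 powr a = 0\<close>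
  and \<open>1 / 0 = 0\<close>.\<close>

section \<open>Convex functions of one variable, and a test for non-coercivity\<close>

lemma C1_differentiable_on_UNIV_has_deriv:
  fixes F :: "real \<Rightarrow> real"
  assumes "F C1_differentiable_on UNIV"
  shows "(F has_real_derivative deriv F t) (at t)"
  using assms
  by (metis C1_differentiable_on_def DERIV_imp_deriv UNIV_I
      has_real_derivative_iff_has_vector_derivative)

lemma log_concave_nonneg: "log_concave h \<Longrightarrow> 0 \<le> h x"
  by (fastforce simp: log_concave_def)

lemma convex_on_above_tangent_UNIV:
  fixes F :: "real \<Rightarrow> real"
  assumes "convex_on UNIV F" "(F has_real_derivative D) (at c)"
  shows "F c + D * (t - c) \<le> F t"
  using convex_on_imp_above_tangent[of UNIV F c t D] assms by simp

text \<open>The horizontal tangent at \<open>c\<close> makes \<open>F c\<close> the least value of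
  \<open>F\<close>; monotonicity bounds \<open>F t\<close> from above to the left of
  \<open>c\<close>.\<close>

lemma mono_convex_zero_deriv_const:
  fixes F :: "real \<Rightarrow> real"
  assumes "mono F" "convex_on UNIV F" "(F has_real_derivative 0) (at c)" "t \<le> c"
  shows "F t = F c"
  using convex_on_above_tangent_UNIV[OF assms(2,3), of t] monoD[OF assms(1,4)] by simp

text \<open>If \<open>c\<close> were nonnegative, \<open>F\<close> would be constant up to
  \<open>c\<close>, which is incompatible with the positive slope at 0. The sign matters later:
  multiplying a negative argument by \<open>t \<ge> 1\<close> moves it further left, within the flat
  part of \<open>F\<close>.\<close>

lemma class_W_zero_deriv_neg:
  assumes F: "F \<in> class_W" and D: "(F has_real_derivative 0) (at c)"
  shows "c < 0"
proof (rule ccontr)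
  assume "\<not> c < 0"
  then have c: "0 \<le> c" by simp
  have W: "mono F" "convex_on UNIV F" "F differentiable (at 0)" "0 < deriv F 0"
    using F by (auto simp: class_W_def)
  then have D0: "(F has_real_derivative deriv F 0) (at 0)"
    by (simp add: DERIV_deriv_iff_real_differentiable)
  have "F 0 = F c"
    using mono_convex_zero_deriv_const[OF W(1,2) D c] .
  then have "deriv F 0 * c \<le> 0"
    using convex_on_above_tangent_UNIV[OF W(2) D0, of c] by simp
  then have "c = 0"
    using W(4) c by (simp add: mult_le_0_iff)
  then show False
    using D W(4) DERIV_imp_deriv by force
qed

lemma not_coercive_on_const_ray:
  fixes f :: "'a::real_normed_vector \<Rightarrow> real"
  assumes "d \<noteq> 0" "\<And>t. 1 \<le> t \<Longrightarrow> t *\<^sub>R d \<in> S" "\<And>t. 1 \<le> t \<Longrightarrow> f (t *\<^sub>R d) = C"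
  shows "\<not> coercive_on S f"
proof
  assume "coercive_on S f"
  then have "\<forall>\<^sub>F p in inf at_infinity (principal S). C < f p"
    unfolding coercive_on_def by (simp add: filterlim_at_top_dense)
  then obtain b where b: "\<And>p. b \<le> norm p \<Longrightarrow> p \<in> S \<Longrightarrow> C < f p"
    by (auto simp: eventually_inf_principal eventually_at_infinity)
  define t where "t = max 1 (b / norm d)"
  have "b / norm d \<le> t" "1 \<le> t" by (auto simp: t_def)
  then have "b \<le> norm (t *\<^sub>R d)"
    using assms(1) by (simp add: divide_le_eq)
  then show False
    using b[of "t *\<^sub>R d"] assms(2,3) \<open>1 \<le> t\<close> by force
qed

section \<open>Linearity, convexity and directional derivatives of the functional\<close>

text \<open>This also covers \<open>h y = 0\<close>: the quotient is then 0 by convention and only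
  the coordinate \<open>\<beta>\<close> remains.\<close>

lemma linear_F_arg: "linear (\<lambda>p. F_arg s h p y)"
  by (rule linearI)
    (auto simp: F_arg_def add_divide_distrib
      scaleR_matrix_vector_assoc[symmetric] algebra_simps)

lemma subspace_sym_space: "subspace sym_space"
  by (auto simp: subspace_def sym_space_def transpose_def vec_eq_iff zero_prod_def)

lemma subspace_Sym0: "subspace (Sym0 s)"
  by (auto simp: subspace_def Sym0_def s_trace_def transpose_def vec_eq_iff zero_prod_def
      trace_def sum.distrib algebra_simps simp flip: sum_distrib_left)
    (simp flip: distrib_left)

lemma convex_on_compose_linear:
  assumes "linear L" "convex_on UNIV F"
  shows "convex_on UNIV (\<lambda>p. F (L p))"
  using assms
  by (auto simp: convex_on_def linear_add linear_scale)

lemma convex_on_sum_fun: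
  assumes "convex S" "\<And>i. i \<in> I \<Longrightarrow> convex_on S (f i)"
  shows "convex_on S (\<lambda>x. \<Sum>i\<in>I. f i x)"
  using assms(2)
  by (induction I rule: infinite_finite_induct)
    (simp_all add: convex_on_add convex_on_const assms(1))

lemma convex_on_I_c:
  assumes "convex_on UNIV F"
  shows "convex_on UNIV (I_c s h F m x)"
  unfolding I_c_def
  by (rule convex_on_sum_fun)
    (simp_all add: convex_on_cmul convex_on_compose_linear[OF linear_F_arg assms])

lemma I_c_has_directional_derivative:
  assumes "\<And>t. (F has_real_derivative F' t) (at t)"
  shows "((\<lambda>t. I_c s h F m x (p + t *\<^sub>R d)) has_real_derivative
    (\<Sum>i = 1..m. h (x i) powr (1 / s) * (F' (F_arg s h p (x i)) * F_arg s h d (x i)))) (at 0)"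
proof -
  have "((\<lambda>t. F (F_arg s h p y + t * F_arg s h d y)) has_real_derivative
      F' (F_arg s h p y) * F_arg s h d y) (at 0)" for y
    by (rule DERIV_chain2[where f = F])
      (auto intro!: derivative_eq_intros assms[of "F_arg s h p y"])
  then show ?thesis
    unfolding I_c_def linear_add[OF linear_F_arg] linear_scale[OF linear_F_arg] real_scaleR_def
    by (intro DERIV_sum DERIV_cmult)
qed

text \<open>Since \<open>S\<close> is a subspace, both signs of \<open>t\<close> are admissible, so
  \<open>t = 0\<close> is an interior minimum on the line through \<open>p\<close>.\<close>

lemma is_arg_min_directional_derivative_zero:
  fixes f :: "'a::real_vector \<Rightarrow> real"
  assumes "is_arg_min f (\<lambda>p. p \<in> S) p" "subspace S" "d \<in> S"
    and "((\<lambda>t. f (p + t *\<^sub>R d)) has_real_derivative D) (at 0)"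
  shows "D = 0"
proof (rule DERIV_local_min[OF assms(4) zero_less_one])
  have "p + t *\<^sub>R d \<in> S" for t
    using assms(1-3) by (auto simp: is_arg_min_def intro: subspace_add subspace_scale)
  then show "\<forall>t. \<bar>0 - t\<bar> < 1 \<longrightarrow> f (p + 0 *\<^sub>R d) \<le> f (p + t *\<^sub>R d)"
    using assms(1) by (auto simp: is_arg_min_def not_less)
qed

section \<open>Outer products, traces, and the decomposition from stationarity\<close>

lemma outer_mult_vec: "outer a b *v y = (b \<bullet> y) *\<^sub>R a"
  by (simp add: outer_def matrix_vector_mult_def vec_eq_iff inner_vec_def sum_distrib_left
      mult_ac)

lemma transpose_outer: "transpose (outer a b) = outer b a"
  by (simp add: outer_def transpose_def vec_eq_iff)

lemma trace_outer: "trace (outer a b) = a \<bullet> b"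
  by (simp add: outer_def trace_def inner_vec_def)

lemma trace_scaleR: "trace (r *\<^sub>R A) = r * trace (A :: real ^ 'n ^ 'n)"
  by (simp add: trace_def sum_distrib_left)

lemma trace_sum: "trace (\<Sum>i\<in>I. A i) = (\<Sum>i\<in>I. trace (A i :: real ^ 'n ^ 'n))"
  unfolding trace_def sum_component by (rule sum.swap)

lemma transpose_add: "transpose (A + B) = transpose A + transpose (B :: real ^ 'n ^ 'm)"
  by (simp add: transpose_def vec_eq_iff)

text \<open>A linear form vanishing on the kernel of the \<open>s\<close>-trace is a multiple of the
  \<open>s\<close>-trace; \<open>\<mu>\<close> is that multiple, read off from the coefficient of
  \<open>\<beta>\<close>. The free vector \<open>w\<close> gives the centering condition.\<close>

lemma weights_of_stationarity:
  fixes x :: "'i \<Rightarrow> real ^ 'n"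
  assumes "s \<noteq> 0"
    and stat: "\<And>M \<beta> w. (M, \<beta>) \<in> Sym0 s \<Longrightarrow>
      (\<Sum>i\<in>I. c i * (x i \<bullet> (M *v x i + w) + r i * \<beta>)) = 0"
  defines "\<mu> \<equiv> (\<Sum>i\<in>I. c i * r i) / s"
  shows "(\<Sum>i\<in>I. c i *\<^sub>R outer (x i) (x i)) = \<mu> *\<^sub>R mat 1" and "(\<Sum>i\<in>I. c i *\<^sub>R x i) = 0"
proof -
  have "(0, 0) \<in> Sym0 s"
    using subspace_0[OF subspace_Sym0] by (simp add: zero_prod_def)
  from stat[OF this] have "(\<Sum>i\<in>I. c i *\<^sub>R x i) \<bullet> w = 0" for w
    by (simp add: inner_sum_left)
  then show "(\<Sum>i\<in>I. c i *\<^sub>R x i) = 0"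
    by (meson inner_eq_zero_iff)
next
  have "(\<Sum>i\<in>I. c i *\<^sub>R outer (x i) (x i)) $ j $ k = (\<mu> *\<^sub>R mat 1) $ j $ k" for j k
  proof -
    define a b where "a = (axis j 1 :: real ^ 'n)" and "b = (axis k 1 :: real ^ 'n)"
    \<comment> \<open>The quadratic form of this symmetric \<open>M\<close> is twice the product of
      coordinates \<open>j\<close> and \<open>k\<close>, so stationarity isolates one matrix entry;
      \<open>\<beta>\<close> is then forced by the vanishing \<open>s\<close>-trace.\<close>
    define M where "M = outer a b + outer b a"
    have tr: "trace M = 2 * (a \<bullet> b)"
      by (simp add: M_def trace_add trace_outer inner_commute)
    then have "(M, - (2 * (a \<bullet> b)) / s) \<in> Sym0 s"
      using \<open>s \<noteq> 0\<close>
      by (simp add: Sym0_def s_trace_def M_def transpose_add transpose_outer add.commute)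
    from stat[OF this, of 0]
    have "0 = (\<Sum>i\<in>I. 2 * (c i * (x i $ j * x i $ k)) - 2 * (a \<bullet> b) / s * (c i * r i))"
      by (simp add: M_def outer_mult_vec a_def b_def inner_axis inner_axis' algebra_simps)
    also have "\<dots> = 2 * (\<Sum>i\<in>I. c i * (x i $ j * x i $ k)) - 2 * (a \<bullet> b) * \<mu>"
      by (simp add: sum_subtractf \<mu>_def sum_distrib_left sum_divide_distrib)
    finally have "(\<Sum>i\<in>I. c i * (x i $ j * x i $ k)) = (a \<bullet> b) * \<mu>"
      by simp
    moreover have "a \<bullet> b = mat 1 $ j $ k"
      by (simp add: a_def b_def mat_def inner_axis_axis)
    ultimately show ?thesis
      by (simp add: outer_def)
  qed
  then show "(\<Sum>i\<in>I. c i *\<^sub>R outer (x i) (x i)) = \<mu> *\<^sub>R mat 1"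
    by (simp add: vec_eq_iff)
qed

section \<open>Nondegeneracy from coercivity\<close>

text \<open>This rules out a zero normalising factor: if all relevant slopes vanished, some ray
  would keep every argument in the flat part of \<open>F\<close>.\<close>

lemma coercive_I_c_positive_slope:
  assumes F: "F \<in> class_W" and F': "\<And>t. (F has_real_derivative F' t) (at t)"
    and coerc: "coercive_on (Sym0 s \<times> UNIV) (I_c s h F m x)" and p: "p \<in> Sym0 s \<times> UNIV"
  obtains i where "i \<in> {1..m}" "h (x i) \<noteq> 0" "F' (F_arg s h p (x i)) \<noteq> 0"
proof (rule ccontr)
  assume "\<not> thesis"
  with that have zero: "F' (F_arg s h p (x i)) = 0" if "i \<in> {1..m}" "h (x i) \<noteq> 0" for i
    using that by blast
  have W: "mono F" "convex_on UNIV F"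
    using F by (auto simp: class_W_def)
  have sub: "subspace (Sym0 s \<times> (UNIV :: (real ^ 'a) set))"
    by (intro subspace_Times subspace_Sym0 subspace_UNIV)
  obtain d where d: "d \<noteq> 0" "d \<in> Sym0 s \<times> UNIV"
    and slope: "\<And>i t. i \<in> {1..m} \<Longrightarrow> h (x i) \<noteq> 0 \<Longrightarrow> 1 \<le> t \<Longrightarrow>
      F_arg s h (t *\<^sub>R d) (x i) \<le> F_arg s h p (x i)"
  \<comment> \<open>For \<open>p = 0\<close> there is no ray through \<open>p\<close>. All arguments
    are then 0, where the slope is positive, so no index has \<open>h (x i) \<noteq> 0\<close>, the
    bound is vacuous and any nonzero direction serves, here a unit vector in
    \<open>w\<close>.\<close>
  proof (cases "p = 0")
    case True
    then have "F_arg s h p (x i) = 0" for i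
      using linear_0[OF linear_F_arg] by simp
    then have False if "i \<in> {1..m}" "h (x i) \<noteq> 0" for i
      using class_W_zero_deriv_neg[OF F, of 0] F'[of 0] zero[OF that] by auto
    moreover have "((0, 0), axis undefined 1) \<in> Sym0 s \<times> (UNIV :: (real ^ 'a) set)"
      using subspace_0[OF subspace_Sym0] by (simp add: zero_prod_def)
    ultimately show thesis
      by (intro that[of "((0, 0), axis undefined 1)"]) (auto simp: zero_prod_def)
  next
    case False
    have "F_arg s h (t *\<^sub>R p) (x i) \<le> F_arg s h p (x i)"
      if "i \<in> {1..m}" "h (x i) \<noteq> 0" "1 \<le> t" for i t
    proof -
      have "F_arg s h p (x i) < 0"
        using class_W_zero_deriv_neg[OF F] F' zero[OF that(1,2)] by metis
      then show ?thesis
        using \<open>1 \<le> t\<close> by (simp add: linear_scale[OF linear_F_arg])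
    qed
    with False p show thesis
      by (intro that[of p])
  qed
  have "I_c s h F m x (t *\<^sub>R d) = I_c s h F m x p" if "1 \<le> t" for t
    unfolding I_c_def
  proof (rule sum.cong[OF refl])
    fix i assume i: "i \<in> {1..m}"
    have "F (F_arg s h (t *\<^sub>R d) (x i)) = F (F_arg s h p (x i))" if h: "h (x i) \<noteq> 0"
      using mono_convex_zero_deriv_const[OF W _ slope[OF i h \<open>1 \<le> t\<close>]] F' zero[OF i h] by metis
    then show "h (x i) powr (1 / s) * F (F_arg s h (t *\<^sub>R d) (x i)) =
        h (x i) powr (1 / s) * F (F_arg s h p (x i))"
      by (cases "h (x i) = 0") auto
  qed
  then have "\<not> coercive_on (Sym0 s \<times> UNIV) (I_c s h F m x)"
    using not_coercive_on_const_ray[of d "Sym0 s \<times> UNIV"] d subspace_scale[OF sub] by blast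
  with coerc show False by blast
qed

section \<open>The weights at a minimum\<close>

theorem corollary1p3:
  fixes s :: real and h :: "real ^ 'n \<Rightarrow> real" and F :: "real \<Rightarrow> real"
    and m :: nat and x :: "nat \<Rightarrow> real ^ 'n"
  assumes "0 < s"
    and "proper_log_concave h"
    and "john_ellipsoid s h (cball 0 1)"
    and "{y \<in> cball 0 1. h y powr (1 / s) = hbar y} = x ` {1..m}"
    and "F \<in> class_W"
    and "F C1_differentiable_on UNIV"
  shows "convex_on sym_space (I_c s h F m x) \<and>
    (coercive_on (Sym0 s \<times> UNIV) (I_c s h F m x) \<longrightarrow>
      (\<forall>M\<^sub>0 \<beta>\<^sub>0 w\<^sub>0. is_arg_min (I_c s h F m x) (\<lambda>p. p \<in> Sym0 s \<times> UNIV) ((M\<^sub>0, \<beta>\<^sub>0), w\<^sub>0) \<longrightarrow>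
        (let \<tau> = (\<lambda>i. (x i \<bullet> (M\<^sub>0 *v x i + w\<^sub>0)) / h (x i) powr (2 / s) + \<beta>\<^sub>0);
             c = (\<lambda>i. 1 / h (x i) powr (1 / s) * deriv F (\<tau> i));
             lam = (\<Sum>i = 1..m. c i) / (real CARD('n) + s)
         in 0 < lam \<and>
            (\<forall>i\<in>{1..m}. 0 \<le> c i) \<and>
            (\<forall>i\<in>{1..m}. 0 < h (x i) \<and> (\<exists>t. F t < F (\<tau> i)) \<longrightarrow> 0 < c i) \<and>
            (\<forall>i\<in>{1..m}. h (x i) = hbar (x i) powr s) \<and>
            (\<Sum>i = 1..m. (c i / lam) *\<^sub>R outer (x i) (x i)) = mat 1 \<and>
            (\<Sum>i = 1..m. (c i / lam) * h (x i) powr (1 / s) * h (x i) powr (1 / s)) = s \<and>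
            (\<Sum>i = 1..m. (c i / lam) *\<^sub>R x i) = 0)))"
proof -
  note s = assms(1) and F = assms(5)
  have W: "mono F" "convex_on UNIV F"
    using F by (auto simp: class_W_def)
  have dF: "(F has_real_derivative deriv F t) (at t)" for t
    using C1_differentiable_on_UNIV_has_deriv[OF assms(6)] .
  \<comment> \<open>The tangent at \<open>t\<close>, evaluated one unit to the left, lies below
    \<open>F (t - 1)\<close>, hence below \<open>F t\<close>.\<close>
  have dF_nonneg: "0 \<le> deriv F t" for t
    using convex_on_above_tangent_UNIV[OF W(2) dF, of t "t - 1"] monoD[OF W(1), of "t - 1" t]
    by simp
  have h_nonneg: "0 \<le> h y" for y
    using assms(2) by (simp add: proper_log_concave_def log_concave_nonneg)
  have contact: "x i \<in> cball 0 1 \<and> h (x i) powr (1 / s) = hbar (x i)" if "i \<in> {1..m}" for i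
    using assms(4) that by blast
  have h_eq: "h (x i) = hbar (x i) powr s" if "i \<in> {1..m}" for i
  proof -
    have "(h (x i) powr (1 / s)) powr s = h (x i)"
      using s h_nonneg[of "x i"] by (simp add: powr_powr)
    with contact[OF that] show ?thesis by simp
  qed
  have h_sq: "h y powr (1 / s) * h y powr (1 / s) = h y powr (2 / s)" for y
    by (simp flip: powr_add)
  \<comment> \<open>The lifted contact point, with last coordinate
    \<open>h (x i) powr (1 / s)\<close>, lies on the unit sphere.\<close>
  have norm_x: "x i \<bullet> x i + h (x i) powr (2 / s) = 1" if "i \<in> {1..m}" for i
  proof -
    have "(norm (x i))\<^sup>2 \<le> 1"
      using contact[OF that] by (simp add: abs_square_le_1)
    then show ?thesis
      using contact[OF that] unfolding h_sq[symmetric]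
      by (simp add: hbar_def power2_norm_eq_inner)
  qed
  have convex: "convex_on sym_space (I_c s h F m x)"
    by (rule convex_on_subset[OF convex_on_I_c[OF W(2)]])
      (simp_all add: subspace_imp_convex subspace_sym_space)
  {
    fix M\<^sub>0 :: "real ^ 'n ^ 'n" and \<beta>\<^sub>0 :: real and w\<^sub>0 :: "real ^ 'n"
    assume coerc: "coercive_on (Sym0 s \<times> UNIV) (I_c s h F m x)"
      and amin: "is_arg_min (I_c s h F m x) (\<lambda>p. p \<in> Sym0 s \<times> UNIV) ((M\<^sub>0, \<beta>\<^sub>0), w\<^sub>0)"
    define p where "p = ((M\<^sub>0, \<beta>\<^sub>0), w\<^sub>0)"
    define \<tau> where "\<tau> = (\<lambda>i. (x i \<bullet> (M\<^sub>0 *v x i + w\<^sub>0)) / h (x i) powr (2 / s) + \<beta>\<^sub>0)"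
    define c where "c = (\<lambda>i. 1 / h (x i) powr (1 / s) * deriv F (\<tau> i))"
    define lam where "lam = (\<Sum>i = 1..m. c i) / (real CARD('n) + s)"
    define \<mu> where "\<mu> = (\<Sum>i = 1..m. c i * h (x i) powr (2 / s)) / s"
    have F_arg_p: "F_arg s h p (x i) = \<tau> i" for i
      by (simp add: \<tau>_def p_def F_arg_def)
    have c_nonneg: "0 \<le> c i" for i
      by (simp add: c_def dF_nonneg)
    have c_pos: "0 < c i" if "h (x i) \<noteq> 0" "deriv F (\<tau> i) \<noteq> 0" for i
      using that dF_nonneg[of "\<tau> i"] by (simp add: c_def)
    \<comment> \<open>The factor \<open>h (x i) powr (1 / s)\<close> in the derivative is
      \<open>c i\<close> without its slope, times \<open>h (x i) powr (2 / s)\<close>, which clears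
      the denominator of \<open>F_arg\<close>. If \<open>h (x i) = 0\<close>, both sides are
      0.\<close>
    have stat: "(\<Sum>i = 1..m. c i * (x i \<bullet> (M *v x i + w) + h (x i) powr (2 / s) * \<beta>)) = 0"
      if "(M, \<beta>) \<in> Sym0 s" for M \<beta> w
    proof -
      define d where "d = ((M, \<beta>), w)"
      have "c i * (x i \<bullet> (M *v x i + w) + h (x i) powr (2 / s) * \<beta>) =
          h (x i) powr (1 / s) * (deriv F (\<tau> i) * F_arg s h d (x i))" for i
      proof (cases "h (x i) = 0")
        case False
        then have "x i \<bullet> (M *v x i + w) + h (x i) powr (2 / s) * \<beta> =
            h (x i) powr (1 / s) * h (x i) powr (1 / s) * F_arg s h d (x i)"
          by (simp add: h_sq F_arg_def d_def distrib_left)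
        with False show ?thesis
          by (simp add: c_def)
      qed (simp add: c_def)
      moreover have "(\<Sum>i = 1..m. h (x i) powr (1 / s) *
          (deriv F (F_arg s h p (x i)) * F_arg s h d (x i))) = 0"
        using amin that
        by (intro is_arg_min_directional_derivative_zero[of "I_c s h F m x" "Sym0 s \<times> UNIV" p d]
            I_c_has_directional_derivative dF subspace_Times subspace_Sym0 subspace_UNIV)
          (simp_all add: p_def d_def)
      ultimately show ?thesis
        by (simp add: F_arg_p)
    qed
    have outer_sum: "(\<Sum>i = 1..m. c i *\<^sub>R outer (x i) (x i)) = \<mu> *\<^sub>R mat 1"
      and x_sum: "(\<Sum>i = 1..m. c i *\<^sub>R x i) = 0"
      using weights_of_stationarity[where I = "{1..m}" and c = c and x = x and s = s
          and r = "\<lambda>i. h (x i) powr (2 / s)"] stat s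
      by (simp_all add: \<mu>_def)
    \<comment> \<open>Adding the trace identity to the one defining \<open>\<mu>\<close> and using
      \<open>norm_x\<close> gives the sum of the weights, which identifies \<open>\<mu>\<close> with
      \<open>lam\<close>.\<close>
    have "(\<Sum>i = 1..m. c i * (x i \<bullet> x i)) = \<mu> * real CARD('n)"
      using arg_cong[OF outer_sum, of trace]
      by (simp add: trace_sum trace_scaleR trace_outer trace_I)
    moreover have h_sum: "(\<Sum>i = 1..m. c i * h (x i) powr (2 / s)) = \<mu> * s"
      using s by (simp add: \<mu>_def)
    moreover have "(\<Sum>i = 1..m. c i) =
        (\<Sum>i = 1..m. c i * (x i \<bullet> x i) + c i * h (x i) powr (2 / s))"
      by (rule sum.cong) (simp_all add: norm_x flip: distrib_left)
    ultimately have "(\<Sum>i = 1..m. c i) = \<mu> * (real CARD('n) + s)"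
      by (simp add: sum.distrib distrib_left)
    then have lam: "lam = \<mu>"
      using s by (simp add: lam_def)
    have p: "p \<in> Sym0 s \<times> UNIV"
      using amin by (simp add: is_arg_min_def p_def)
    obtain i where i: "i \<in> {1..m}" "h (x i) \<noteq> 0" "deriv F (\<tau> i) \<noteq> 0"
      by (rule coercive_I_c_positive_slope[OF F dF coerc p, unfolded F_arg_p])
    then have "0 < (\<Sum>i = 1..m. c i)"
      using c_pos c_nonneg by (intro sum_pos2[of _ i]) auto
    then have lam_pos: "0 < lam"
      using s by (simp add: lam_def)
    \<comment> \<open>A zero slope at \<open>\<tau> i\<close> would make \<open>F (\<tau> i)\<close>
      the least value of \<open>F\<close>.\<close>
    have c_pos_if: "0 < c i" if "0 < h (x i)" "F t < F (\<tau> i)" for i t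
    proof (rule c_pos)
      show "deriv F (\<tau> i) \<noteq> 0"
        using convex_on_above_tangent_UNIV[OF W(2) dF, of "\<tau> i" t] that(2) by auto
    qed (use that(1) in simp)
    have "(\<Sum>i = 1..m. (c i / lam) *\<^sub>R outer (x i) (x i)) =
        (1 / lam) *\<^sub>R (\<Sum>i = 1..m. c i *\<^sub>R outer (x i) (x i))"
      by (simp add: scaleR_sum_right)
    then have outer_id: "(\<Sum>i = 1..m. (c i / lam) *\<^sub>R outer (x i) (x i)) = mat 1"
      using lam lam_pos outer_sum by simp
    have "(\<Sum>i = 1..m. (c i / lam) * h (x i) powr (1 / s) * h (x i) powr (1 / s)) =
        (\<Sum>i = 1..m. c i * h (x i) powr (2 / s)) / lam"
      by (simp add: mult.assoc h_sq sum_divide_distrib)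
    then have h_id:
      "(\<Sum>i = 1..m. (c i / lam) * h (x i) powr (1 / s) * h (x i) powr (1 / s)) = s"
      using lam lam_pos h_sum by simp
    have "(\<Sum>i = 1..m. (c i / lam) *\<^sub>R x i) = (1 / lam) *\<^sub>R (\<Sum>i = 1..m. c i *\<^sub>R x i)"
      by (simp add: scaleR_sum_right)
    then have x_id: "(\<Sum>i = 1..m. (c i / lam) *\<^sub>R x i) = 0"
      using x_sum by simp
    have pos: "\<forall>i\<in>{1..m}. 0 < h (x i) \<and> (\<exists>t. F t < F (\<tau> i)) \<longrightarrow> 0 < c i"
      using c_pos_if by blast
    \<comment> \<open>The conjuncts follow the order of the goal; unfolding the local abbreviations
      gives the exported fact the form of the goal after \<open>Let_def\<close>.\<close>
    note conjI[OF lam_pos conjI[OF ballI[OF c_nonneg] conjI[OF pos conjI[OF ballI[OF h_eq]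
      conjI[OF outer_id conjI[OF h_id x_id]]]]]]
    note this[unfolded lam_def c_def \<tau>_def]
  }
  note weights = this
  show ?thesis
    unfolding Let_def by (intro conjI[OF convex] impI allI weights)
qed

end
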